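(* For all $p,q\in\mathbb{N}_0$ and $n\in\mathbb{N}_0$, \[ \sum_{k=0}^n(-1)^k\binom{p+k}{k}\binom{q+n}{n-k}H_{p+k}H_{q+k}= \begin{cases} U_n, & \text{if } p-q\geq n,\\ V_n, & \text{if } 0\leq p-q<n,\\ W_n, & \text{if } p-q<0, \end{cases} \] where \[ U_n=(-1)^n\binom{p-q}{n}\Big\{\big(H_{p-q-n}^{\langle 2\rangle}-H_{p-q}^{\langle 2\rangle}\big)+\big(H_p+H_{p-q}-H_{p-q-n}\big)\big(H_{q+n}+H_{p-q}-H_{p-q-n}\big)\Big\}, \] \[ V_n=(-1)^{1+p-q}\frac{(p-q)!\,(q-p+n-1)!}{n!}\Big\{H_p+H_{q+n}+2H_{p-q}-2H_{q-p+n}+\frac{2}{q-p+n}\Big\}, \] \[ W_n=(-1)^n\binom{p-q}{n}\Big\{\big(H_{q-p-1}^{\langle 2\rangle}-H_{q-p+n-1}^{\langle 2\rangle}\big)+\big(H_p+H_{q-p-1}-H_{q-p+n-1}\big)\big(H_{q+n}+H_{q-p-1}-H_{q-p+n-1}\big)\Big\}. \]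
   Context: $\mathbb{N}_0$ denotes the set of nonnegative integers and $\mathbb{N}$ the set of positive integers. For $l\in\mathbb{N}$ the generalized harmonic numbers are $H_0^{\langle l\rangle}=0$ and $H_n^{\langle l\rangle}=\sum_{k=1}^n\frac{1}{k^l}$ for $n\ge 1$. The classical harmonic numbers are $H_n=H_n^{\langle 1\rangle}$, so $H_0=0$ and $H_n=\sum_{k=1}^n\frac1k$. Binomial coefficients with possibly negative upper entry are the generalized ones: $\binom{x}{m}=\frac{x(x-1)\cdots(x-m+1)}{m!}$ for $m\in\mathbb{N}_0$, with $\binom{x}{0}=1$. Each of $U_n,V_n,W_n$ is only considered in the range of parameters of its own case. *)

theory Defs
  imports "HOL-Analysis.Harmonic_Numbers"
begin

definition gen_harm :: "nat \<Rightarrow> nat \<Rightarrow> real" where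
  "gen_harm l n = (\<Sum>k=1..n. 1 / real k ^ l)"

lemma gen_harm_0 [simp]: "gen_harm l 0 = 0"
  by (simp add: gen_harm_def)

lemma gen_harm_1: "gen_harm 1 n = harm n"
  by (simp add: gen_harm_def harm_def inverse_eq_divide)

text \<open>
  The closed forms are total functions, but each is meaningful only in its own range of
  parameters; there every subtraction of natural numbers below is exact. In particular
  \<open>q + n - p\<close> stands for $q - p + n$, which is positive when $0 \le p - q < n$ although
  $q - p$ need not be. The upper entry of \<open>gchoose\<close> is the difference of reals,
  since it may be negative.
\<close>

text \<open>Range: $p - q \ge n$.\<close>
definition U :: "nat \<Rightarrow> nat \<Rightarrow> nat \<Rightarrow> real" where
  "U p q n = (-1) ^ n * ((real p - real q) gchoose n) *
     ((gen_harm 2 (p - q - n) - gen_harm 2 (p - q)) +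
      (harm p + harm (p - q) - harm (p - q - n)) *
      (harm (q + n) + harm (p - q) - harm (p - q - n)))"

text \<open>Range: $0 \le p - q < n$.\<close>
definition V :: "nat \<Rightarrow> nat \<Rightarrow> nat \<Rightarrow> real" where
  "V p q n = (-1) ^ (1 + (p - q)) * (fact (p - q) * fact (q + n - p - 1) / fact n) *
     (harm p + harm (q + n) + 2 * harm (p - q) - 2 * harm (q + n - p) + 2 / real (q + n - p))"

text \<open>Range: $p - q < 0$.\<close>
definition W :: "nat \<Rightarrow> nat \<Rightarrow> nat \<Rightarrow> real" where
  "W p q n = (-1) ^ n * ((real p - real q) gchoose n) *
     ((gen_harm 2 (q - p - 1) - gen_harm 2 (q - p + n - 1)) +
      (harm p + harm (q - p - 1) - harm (q - p + n - 1)) *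
      (harm (q + n) + harm (q - p - 1) - harm (q - p + n - 1)))"

end

theory Submission
  imports Defs "HOL-Computational_Algebra.Polynomial"
begin

text \<open>
  Vandermonde's convolution, with \<open>p\<close> and \<open>q\<close> replaced by real variables, reads
  \[ \sum_{k=0}^n (-1)^k \binom{x+k}{k} \binom{y+n}{n-k} = g(x-y), \qquad
     g(t) = (-1)^n \binom{t}{n}. \]
  Harmonic numbers are logarithmic derivatives of binomial coefficients: at natural \<open>p\<close>, the
  operator $H_p + \partial_x$ multiplies $\binom{x+k}{k}$ by $H_{p+k}$, and at natural \<open>q\<close>, the
  operator $H_{q+n} - \partial_y$ multiplies $\binom{y+n}{n-k}$ by $H_{q+k}$. Applying both
  operators to the convolution turns its left side into the required sum; since the right side
  depends on $x - y$ only, the result (lemma \<open>harmonic_convolution\<close>) is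
  \[ H_p H_{q+n}\, g(t) + (H_p + H_{q+n})\, g'(t) + g''(t), \qquad t = p - q. \]

  The three cases say where \<open>t\<close> lies relative to the roots $0, \dots, n-1$ of \<open>g\<close>. Above or below
  all of them, the derivatives of \<open>g\<close> come from the power sums $\sum_{i<n} (t-i)^{-1}$ and
  $\sum_{i<n} (t-i)^{-2}$, which are differences of harmonic numbers; this gives \<open>U\<close> and \<open>W\<close>.
  If \<open>t\<close> is a root, then $g(t) = 0$, and $g'(t)$, $g''(t)$ are governed by the product of the
  remaining linear factors; this gives \<open>V\<close>.
\<close>

section \<open>Derivatives of products of linear factors\<close>

text \<open>
  Logarithmic differentiation. Formal derivatives of polynomials make the second derivative
  available without any statement about the first one in a neighbourhood of \<open>t\<close>.
\<close>

lemma pderiv_prod_linear: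
  fixes r :: "'i \<Rightarrow> 'a::field_char_0"
  assumes "finite A" "\<And>i. i \<in> A \<Longrightarrow> t \<noteq> r i"
  defines "P \<equiv> \<Prod>i\<in>A. [:- r i, 1:]"
  shows "poly (pderiv P) t = poly P t * (\<Sum>i\<in>A. 1 / (t - r i))"
    and "poly (pderiv (pderiv P)) t =
           poly P t * ((\<Sum>i\<in>A. 1 / (t - r i))\<^sup>2 - (\<Sum>i\<in>A. 1 / (t - r i)\<^sup>2))"
proof -
  have "poly (pderiv P) t = poly P t * (\<Sum>i\<in>A. 1 / (t - r i)) \<and>
        poly (pderiv (pderiv P)) t =
          poly P t * ((\<Sum>i\<in>A. 1 / (t - r i))\<^sup>2 - (\<Sum>i\<in>A. 1 / (t - r i)\<^sup>2))"
    using assms(1,2) unfolding P_def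
  proof (induction A rule: finite_induct)
    case empty
    then show ?case by simp
  next
    case (insert a A)
    define Q where "Q = (\<Prod>i\<in>A. [:- r i, 1:])"
    define d where "d = t - r a"
    define s1 where "s1 = (\<Sum>i\<in>A. 1 / (t - r i))"
    define s2 where "s2 = (\<Sum>i\<in>A. 1 / (t - r i)\<^sup>2)"
    have d: "d \<noteq> 0" using insert.prems by (simp add: d_def)
    have IH: "poly (pderiv Q) t = poly Q t * s1"
      "poly (pderiv (pderiv Q)) t = poly Q t * (s1\<^sup>2 - s2)"
      using insert unfolding Q_def s1_def s2_def by auto
    have P: "(\<Prod>i\<in>insert a A. [:- r i, 1:]) = [:- r a, 1:] * Q"
      using insert.hyps by (simp add: Q_def del: mult_pCons_left)
    have lin: "pderiv [:- r a, 1:] = 1" "poly [:- r a, 1:] t = d"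
      by (simp_all add: pderiv_pCons d_def one_pCons)
    have S: "(\<Sum>i\<in>insert a A. 1 / (t - r i)) = 1 / d + s1"
            "(\<Sum>i\<in>insert a A. 1 / (t - r i)\<^sup>2) = 1 / d\<^sup>2 + s2"
      using insert.hyps by (simp_all add: s1_def s2_def d_def)
    have 1: "poly (pderiv ([:- r a, 1:] * Q)) t = poly Q t + d * poly (pderiv Q) t"
      by (simp only: pderiv_mult lin poly_add poly_mult) simp
    have 2: "poly (pderiv (pderiv ([:- r a, 1:] * Q))) t =
               2 * poly (pderiv Q) t + d * poly (pderiv (pderiv Q)) t"
      by (simp only: pderiv_mult pderiv_add lin poly_add poly_mult) simp
    have 0: "poly ([:- r a, 1:] * Q) t = d * poly Q t"
      by (simp only: lin poly_mult)
    show ?case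
      unfolding P S 0 1 2 IH using d
      by (simp add: field_simps power2_eq_square)
  qed
  then show "poly (pderiv P) t = poly P t * (\<Sum>i\<in>A. 1 / (t - r i))"
    and "poly (pderiv (pderiv P)) t =
           poly P t * ((\<Sum>i\<in>A. 1 / (t - r i))\<^sup>2 - (\<Sum>i\<in>A. 1 / (t - r i)\<^sup>2))"
    by simp_all
qed

lemma pderiv_linear_mult_at_root:
  fixes Q :: "'a::field_char_0 poly"
  shows "poly (pderiv ([:- a, 1:] * Q)) a = poly Q a"
    and "poly (pderiv (pderiv ([:- a, 1:] * Q))) a = 2 * poly (pderiv Q) a"
proof -
  have lin: "pderiv [:- a, 1:] = 1" "poly [:- a, 1:] a = 0"
    by (simp_all add: pderiv_pCons one_pCons)
  show "poly (pderiv ([:- a, 1:] * Q)) a = poly Q a"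
    by (simp only: pderiv_mult lin poly_add poly_mult) simp
  show "poly (pderiv (pderiv ([:- a, 1:] * Q))) a = 2 * poly (pderiv Q) a"
    by (simp only: pderiv_mult pderiv_add lin poly_add poly_mult) simp
qed

section \<open>Binomial coefficients as polynomials in the upper entry\<close>

definition gbinomial_poly :: "nat \<Rightarrow> real poly" where
  "gbinomial_poly n = smult (1 / fact n) (\<Prod>i<n. [:- real i, 1:])"

lemma poly_gbinomial_poly [simp]: "poly (gbinomial_poly n) t = t gchoose n"
  by (simp add: gbinomial_poly_def gbinomial_prod_rev poly_prod lessThan_atLeast0)

lemma pderiv_gbinomial_poly_off_roots:
  assumes "\<And>i. i < n \<Longrightarrow> t \<noteq> real i"
  shows "poly (pderiv (gbinomial_poly n)) t = (t gchoose n) * (\<Sum>i<n. 1 / (t - real i))"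
    and "poly (pderiv (pderiv (gbinomial_poly n))) t =
           (t gchoose n) * ((\<Sum>i<n. 1 / (t - real i))\<^sup>2 - (\<Sum>i<n. 1 / (t - real i)\<^sup>2))"
proof -
  have g: "t gchoose n = 1 / fact n * poly (\<Prod>i<n. [:- real i, 1:]) t"
    by (simp add: gbinomial_prod_rev poly_prod lessThan_atLeast0)
  note D = pderiv_prod_linear[of "{..<n}" t real]
  show "poly (pderiv (gbinomial_poly n)) t = (t gchoose n) * (\<Sum>i<n. 1 / (t - real i))"
    using D(1) assms by (simp add: gbinomial_poly_def pderiv_smult g)
  show "poly (pderiv (pderiv (gbinomial_poly n))) t =
           (t gchoose n) * ((\<Sum>i<n. 1 / (t - real i))\<^sup>2 - (\<Sum>i<n. 1 / (t - real i)\<^sup>2))"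
    using D(2) assms by (simp add: gbinomial_poly_def pderiv_smult g)
qed

lemma sum_inverse_consecutive:
  assumes "j \<le> a"
  shows "(\<Sum>i<j. 1 / (real a - real i) ^ l) = gen_harm l a - gen_harm l (a - j)"
  using assms
proof (induction j)
  case (Suc j)
  have a: "a - j = Suc (a - Suc j)" using Suc.prems by simp
  have "gen_harm l (a - j) = gen_harm l (a - Suc j) + 1 / real (a - j) ^ l"
    by (subst (1 2) a) (simp add: gen_harm_def)
  moreover have "real (a - j) = real a - real j" using Suc.prems by simp
  ultimately show ?case using Suc by simp
qed simp

lemma sum_inverse_consecutive_harm:
  assumes "j \<le> a"
  shows "(\<Sum>i<j. 1 / (real a - real i)) = harm a - harm (a - j)"
  using sum_inverse_consecutive[OF assms, of 1] by (simp add: gen_harm_1 del: One_nat_def)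

text \<open>
  For \<open>j = k\<close> and \<open>a = p + k\<close> the logarithmic derivative is $H_{p+k} - H_p$; for \<open>j = n - k\<close> and \<open>a = q + n\<close> it
  is $H_{q+n} - H_{q+k}$.
\<close>

lemma has_field_derivative_gbinomial:
  assumes "j \<le> a"
  shows "((\<lambda>x. x gchoose j) has_field_derivative
           real (a choose j) * (harm a - harm (a - j))) (at (real a))"
proof -
  have "poly (pderiv (gbinomial_poly j)) (real a) =
          real (a choose j) * (harm a - harm (a - j))"
    using pderiv_gbinomial_poly_off_roots(1)[of j "real a"] assms
    by (simp add: sum_inverse_consecutive_harm binomial_gbinomial)
  then show ?thesis
    using poly_DERIV[of "gbinomial_poly j" "real a"] by simp
qed

section \<open>Differentiating Vandermonde's convolution\<close>

lemma alternating_Vandermonde: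
  fixes x y :: real
  shows "(\<Sum>k\<le>n. (-1) ^ k * (x + real k gchoose k) * (y + real n gchoose (n - k))) =
           (-1) ^ n * (x - y gchoose n)"
proof -
  have "(-1) ^ k * (x + real k gchoose k) = (- x - 1 gchoose k)" for k
    using gbinomial_negated_upper[of "- x - 1" k] by (simp add: algebra_simps)
  then have "(\<Sum>k\<le>n. (-1) ^ k * (x + real k gchoose k) * (y + real n gchoose (n - k))) =
               (- x - 1) + (y + real n) gchoose n"
    using gbinomial_Vandermonde[of "- x - 1" "y + real n" n] by (simp add: atMost_atLeast0)
  also have "\<dots> = (-1) ^ n * (x - y gchoose n)"
    using gbinomial_negated_upper[of "- x - 1 + (y + real n)" n] by (simp add: algebra_simps)
  finally show ?thesis .
qed

lemma has_field_derivative_poly_affine: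
  "((\<lambda>x. poly P (c + s * x)) has_field_derivative s * poly (pderiv P) (c + s * x)) (at x)"
  for P :: "real poly"
  by (auto intro!: derivative_eq_intros DERIV_chain'[OF _ poly_DERIV])

lemma harmonic_convolution:
  fixes p q n :: nat
  defines "t \<equiv> real p - real q"
  shows "(\<Sum>k\<le>n. (-1) ^ k * real ((p + k) choose k) * real ((q + n) choose (n - k)) *
            harm (p + k) * harm (q + k)) =
         (-1) ^ n * (harm p * harm (q + n) * (t gchoose n)
           + (harm p + harm (q + n)) * poly (pderiv (gbinomial_poly n)) t
           + poly (pderiv (pderiv (gbinomial_poly n))) t)"
proof -
  define g where "g = gbinomial_poly n"
  define a where "a k = (-1) ^ k * real ((p + k) choose k)" for k
  define b where "b k = real ((q + n) choose (n - k))" for k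
  define u where "u k = harm (p + k) - (harm p :: real)" for k
  define v where "v k = harm (q + n) - (harm (q + k) :: real)" for k

  \<comment> \<open>Here \<open>u\<close> and \<open>v\<close> are the logarithmic derivatives of the two binomial coefficients.\<close>
  have dx: "((\<lambda>x. (-1) ^ k * (x + real k gchoose k)) has_field_derivative a k * u k) (at (real p))"
    for k
  proof -
    have "((\<lambda>x. x + real k gchoose k) has_field_derivative
            real ((p + k) choose k) * u k) (at (real p))"
      using has_field_derivative_gbinomial[of k "p + k"]
      by (simp add: u_def DERIV_shift)
    then show ?thesis
      unfolding a_def mult.assoc by (rule DERIV_cmult)
  qed
  have dy: "((\<lambda>y. y + real n gchoose (n - k)) has_field_derivative b k * v k) (at (real q))"
    if "k \<le> n" for k
    using has_field_derivative_gbinomial[of "n - k" "q + n"] that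
    by (simp add: b_def v_def DERIV_shift)

  have f: "(\<Sum>k\<le>n. a k * (y + real n gchoose (n - k))) = (-1) ^ n * poly g (real p - y)" for y
    using alternating_Vandermonde[where x = "real p" and y = y and n = n]
    by (simp add: a_def g_def binomial_gbinomial)
  \<comment> \<open>The identities \<open>f\<close> and \<open>fx\<close> hold for every real \<open>y\<close>, so both may be differentiated in \<open>y\<close>
      by the same argument; \<open>fx\<close> then yields the mixed second derivative.\<close>
  have fx: "(\<Sum>k\<le>n. a k * u k * (y + real n gchoose (n - k))) =
              (-1) ^ n * poly (pderiv g) (real p - y)" for y
  proof (rule DERIV_unique)
    show "((\<lambda>x. \<Sum>k\<le>n. (-1) ^ k * (x + real k gchoose k) * (y + real n gchoose (n - k)))
            has_field_derivative (\<Sum>k\<le>n. a k * u k * (y + real n gchoose (n - k)))) (at (real p))"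
      by (intro DERIV_sum DERIV_cmult_right dx)
    have "((\<lambda>x. (-1) ^ n * poly g (x - y)) has_field_derivative
            (-1) ^ n * poly (pderiv g) (real p - y)) (at (real p))"
      using has_field_derivative_poly_affine[of g "- y" 1 "real p"]
      by (intro DERIV_cmult) simp
    then show "((\<lambda>x. \<Sum>k\<le>n. (-1) ^ k * (x + real k gchoose k) * (y + real n gchoose (n - k)))
            has_field_derivative (-1) ^ n * poly (pderiv g) (real p - y)) (at (real p))"
      by (simp add: alternating_Vandermonde g_def)
  qed

  have diff_y: "(\<Sum>k\<le>n. c k * (b k * v k)) = - ((-1) ^ n * poly (pderiv G) t)"
    if "\<And>y. (\<Sum>k\<le>n. c k * (y + real n gchoose (n - k))) = (-1) ^ n * poly G (real p - y)"
    for c and G :: "real poly"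
  proof (rule DERIV_unique)
    show "((\<lambda>y. \<Sum>k\<le>n. c k * (y + real n gchoose (n - k)))
            has_field_derivative (\<Sum>k\<le>n. c k * (b k * v k))) (at (real q))"
      by (intro DERIV_sum DERIV_cmult dy) simp
    have "((\<lambda>y. (-1) ^ n * poly G (real p - y)) has_field_derivative
            (-1) ^ n * (- poly (pderiv G) t)) (at (real q))"
      using has_field_derivative_poly_affine[of G "real p" "- 1" "real q"]
      by (intro DERIV_cmult) (simp add: t_def)
    then show "((\<lambda>y. \<Sum>k\<le>n. c k * (y + real n gchoose (n - k)))
            has_field_derivative - ((-1) ^ n * poly (pderiv G) t)) (at (real q))"
      by (simp add: that)
  qed

  have b: "real q + real n gchoose (n - k) = b k" for k
    by (simp add: b_def binomial_gbinomial)
  have s0: "(\<Sum>k\<le>n. a k * b k) = (-1) ^ n * poly g t"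
    using f[of "real q"] by (simp add: b t_def)
  have sx: "(\<Sum>k\<le>n. a k * u k * b k) = (-1) ^ n * poly (pderiv g) t"
    using fx[of "real q"] by (simp add: b t_def)
  have sy: "(\<Sum>k\<le>n. a k * (b k * v k)) = - ((-1) ^ n * poly (pderiv g) t)"
    by (rule diff_y[OF f])
  have sxy: "(\<Sum>k\<le>n. a k * u k * (b k * v k)) = - ((-1) ^ n * poly (pderiv (pderiv g)) t)"
    by (rule diff_y[OF fx])

  have "(\<Sum>k\<le>n. (-1) ^ k * real ((p + k) choose k) * real ((q + n) choose (n - k)) *
            harm (p + k) * harm (q + k)) =
        (\<Sum>k\<le>n. a k * b k * (harm p + u k) * (harm (q + n) - v k))"
    by (simp add: a_def b_def u_def v_def)
  also have "\<dots> = harm p * harm (q + n) * (\<Sum>k\<le>n. a k * b k)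
      + harm (q + n) * (\<Sum>k\<le>n. a k * u k * b k)
      - harm p * (\<Sum>k\<le>n. a k * (b k * v k)) - (\<Sum>k\<le>n. a k * u k * (b k * v k))"
    by (simp add: sum_distrib_left algebra_simps flip: sum.distrib sum_subtractf)
  also have "\<dots> = (-1) ^ n * (harm p * harm (q + n) * (t gchoose n)
           + (harm p + harm (q + n)) * poly (pderiv (gbinomial_poly n)) t
           + poly (pderiv (pderiv (gbinomial_poly n))) t)"
    unfolding s0 sx sy sxy by (simp add: g_def algebra_simps)
  finally show ?thesis .
qed

section \<open>Evaluation on and off the roots\<close>

text \<open>
  The common shape of \<open>U\<close> and \<open>W\<close>: they differ only in how the two power sums are written
  by harmonic numbers.
\<close>

lemma harmonic_convolution_off_roots:
  fixes p q n :: nat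
  defines "t \<equiv> real p - real q"
  assumes "\<And>i. i < n \<Longrightarrow> t \<noteq> real i"
  defines "s \<equiv> \<Sum>i<n. 1 / (t - real i)"
  shows "(\<Sum>k\<le>n. (-1) ^ k * real ((p + k) choose k) * real ((q + n) choose (n - k)) *
            harm (p + k) * harm (q + k)) =
         (-1) ^ n * (t gchoose n) *
           (- (\<Sum>i<n. 1 / (t - real i)\<^sup>2) + (harm p + s) * (harm (q + n) + s))"
  using harmonic_convolution[where p = p and q = q and n = n]
    pderiv_gbinomial_poly_off_roots[OF assms(2)]
  by (simp flip: t_def s_def) (simp add: algebra_simps power2_eq_square)

lemma sum_split_at:
  fixes f :: "nat \<Rightarrow> 'a::comm_monoid_add"
  assumes "m < n"
  shows "sum f ({..<n} - {m}) = sum f {..<m} + (\<Sum>i<n - 1 - m. f (Suc (m + i)))"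
proof -
  have split: "{..<n} - {m} = {..<m} \<union> {Suc m..<n}" using assms by auto
  have "sum f ({..<n} - {m}) = sum f {..<m} + sum f {Suc m..<n}"
    unfolding split by (rule sum.union_disjoint) auto
  also have "sum f {Suc m..<n} = (\<Sum>i<n - 1 - m. f (Suc (m + i)))"
    by (rule sum.reindex_bij_witness[of _ "\<lambda>i. Suc (m + i)" "\<lambda>i. i - Suc m"]) auto
  finally show ?thesis .
qed

lemma prod_split_at:
  fixes f :: "nat \<Rightarrow> 'a::comm_monoid_mult"
  assumes "m < n"
  shows "prod f ({..<n} - {m}) = prod f {..<m} * (\<Prod>i<n - 1 - m. f (Suc (m + i)))"
proof -
  have split: "{..<n} - {m} = {..<m} \<union> {Suc m..<n}" using assms by auto
  have "prod f ({..<n} - {m}) = prod f {..<m} * prod f {Suc m..<n}"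
    unfolding split by (rule prod.union_disjoint) auto
  also have "prod f {Suc m..<n} = (\<Prod>i<n - 1 - m. f (Suc (m + i)))"
    by (rule prod.reindex_bij_witness[of _ "\<lambda>i. Suc (m + i)" "\<lambda>i. i - Suc m"]) auto
  finally show ?thesis .
qed

text \<open>
  At the root \<open>m\<close> only the product \<open>Q\<close> of the other linear factors matters, through its value
  and its logarithmic derivative. The factors with \<open>i < m\<close> are $m, \dots, 1$ and those with
  \<open>i > m\<close> are $-1, \dots, -(n-1-m)$.
\<close>

lemma pderiv_gbinomial_poly_at_root:
  assumes "m < n"
  defines "c \<equiv> (-1) ^ (n - 1 - m) * (fact m * fact (n - 1 - m) / fact n)"
  shows "poly (pderiv (gbinomial_poly n)) (real m) = c"
    and "poly (pderiv (pderiv (gbinomial_poly n))) (real m) =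
           2 * c * (harm m - harm (n - 1 - m))"
proof -
  define Q where "Q = (\<Prod>i\<in>{..<n} - {m}. [:- real i, 1:])"
  have P: "gbinomial_poly n = smult (1 / fact n) ([:- real m, 1:] * Q)"
    using assms prod.remove[of "{..<n}" m "\<lambda>i. [:- real i, 1:]"]
    by (simp add: gbinomial_poly_def Q_def del: mult_pCons_left)
  have "poly Q (real m) = (\<Prod>i\<in>{..<n} - {m}. real m - real i)"
    by (simp add: Q_def poly_prod)
  also have "\<dots> = (\<Prod>i<m. real m - real i) * (\<Prod>i<n - 1 - m. - real (Suc i))"
    by (simp add: prod_split_at[OF assms(1)])
  also have "(\<Prod>i<m. real m - real i) = fact m"
    using gbinomial_mult_fact[of m "real m"]
    by (simp add: lessThan_atLeast0 flip: binomial_gbinomial)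
  also have "(\<Prod>i<n - 1 - m. - real (Suc i)) = (-1) ^ (n - 1 - m) * fact (n - 1 - m)"
    by (simp only: prod_uminus fact_prod_Suc lessThan_atLeast0) simp
  finally have Q: "poly Q (real m) = fact m * ((-1) ^ (n - 1 - m) * fact (n - 1 - m))" .
  have "poly (pderiv Q) (real m) =
          poly Q (real m) * (\<Sum>i\<in>{..<n} - {m}. 1 / (real m - real i))"
    unfolding Q_def by (rule pderiv_prod_linear) auto
  also have "(\<Sum>i\<in>{..<n} - {m}. 1 / (real m - real i)) =
               (\<Sum>i<m. 1 / (real m - real i)) - (\<Sum>i<n - 1 - m. 1 / real (Suc i))"
  proof -
    have "1 / (real m - real (Suc (m + i))) = - (1 / real (Suc i))" for i
    proof -
      have "real m - real (Suc (m + i)) = - real (Suc i)" by simp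
      then show ?thesis by (simp only: minus_divide_right)
    qed
    then show ?thesis
      unfolding sum_split_at[OF assms(1)] by (simp only: sum_negf diff_conv_add_uminus)
  qed
  also have "(\<Sum>i<m. 1 / (real m - real i)) = harm m"
    using sum_inverse_consecutive_harm[of m m] by (simp add: harm_def)
  also have "(\<Sum>i<n - 1 - m. 1 / real (Suc i)) = harm (n - 1 - m)"
    by (simp add: harm_altdef inverse_eq_divide)
  finally have Q': "poly (pderiv Q) (real m) = poly Q (real m) * (harm m - harm (n - 1 - m))" .
  note D = pderiv_linear_mult_at_root[of "real m" Q]
  show "poly (pderiv (gbinomial_poly n)) (real m) = c"
    unfolding P pderiv_smult poly_smult D Q by (simp add: c_def)
  show "poly (pderiv (pderiv (gbinomial_poly n))) (real m) =
           2 * c * (harm m - harm (n - 1 - m))"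
    unfolding P pderiv_smult poly_smult D Q' Q by (simp add: c_def)
qed

theorem theorem5:
  fixes p q n :: nat
  shows "(\<Sum>k=0..n. (-1) ^ k * real ((p + k) choose k) * real ((q + n) choose (n - k)) *
            harm (p + k) * harm (q + k)) =
         (if int p - int q \<ge> int n then U p q n
          else if 0 \<le> int p - int q \<and> int p - int q < int n then V p q n
          else W p q n)"
proof -
  define S where "S = (\<Sum>k\<le>n. (-1) ^ k * real ((p + k) choose k) *
                         real ((q + n) choose (n - k)) * harm (p + k) * harm (q + k))"
  define t where "t = real p - real q"
  consider (above) "q + n \<le> p" | (root) "q \<le> p" "p < q + n" | (below) "p < q"
    by linarith
  then have "S = (if int p - int q \<ge> int n then U p q n
          else if 0 \<le> int p - int q \<and> int p - int q < int n then V p q n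
          else W p q n)"
  proof cases
    case above
    have t: "t = real (p - q)" using above by (simp add: t_def of_nat_diff)
    have off: "t \<noteq> real i" if "i < n" for i using that above unfolding t by simp
    have s1: "(\<Sum>i<n. 1 / (t - real i)) = harm (p - q) - harm (p - q - n)"
      using above unfolding t by (intro sum_inverse_consecutive_harm) simp
    have s2: "(\<Sum>i<n. 1 / (t - real i)\<^sup>2) = gen_harm 2 (p - q) - gen_harm 2 (p - q - n)"
      using above unfolding t by (intro sum_inverse_consecutive) simp
    have "S = U p q n"
      using harmonic_convolution_off_roots[of n p q, folded t_def S_def, OF off]
      unfolding s1 s2 by (simp add: U_def t_def algebra_simps)
    then show ?thesis using above by simp
  next
    case root
    define m where "m = p - q"
    have m: "m < n" "t = real m" using root by (simp_all add: m_def t_def of_nat_diff)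
    have "q + n - p = Suc (n - 1 - m)" using root by (simp add: m_def)
    then have h: "(harm (n - 1 - m) :: real) = harm (q + n - p) - 1 / real (q + n - p)"
      and e: "n - 1 - m = q + n - p - 1"
      by (simp_all add: harm_Suc inverse_eq_divide)
    have "n + (n - 1 - m) = 1 + m + 2 * (n - 1 - m)" using m by simp
    then have sign: "(-1::real) ^ n * (-1) ^ (n - 1 - m) = (-1) ^ (1 + m)"
      by (simp only: power_add[symmetric]) (simp add: power_add power_mult)
    have g: "real m gchoose n = 0"
      using m by (simp flip: binomial_gbinomial)
    define c where "c = (-1::real) ^ (n - 1 - m) * (fact m * fact (n - 1 - m) / fact n)"
    have "S = (-1) ^ n * ((harm p + harm (q + n)) * c + 2 * c * (harm m - harm (n - 1 - m)))"
      using harmonic_convolution[where p = p and q = q and n = n, folded t_def S_def]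
      unfolding m(2) pderiv_gbinomial_poly_at_root[OF m(1), folded c_def] g by simp
    also have "\<dots> = (-1) ^ n * c *
        (harm p + harm (q + n) + 2 * (harm m - harm (n - 1 - m)))"
      by (simp add: algebra_simps)
    finally have "S = (-1) ^ n * (-1) ^ (n - 1 - m) * (fact m * fact (n - 1 - m) / fact n) *
        (harm p + harm (q + n) + 2 * (harm m - harm (n - 1 - m)))"
      by (simp only: c_def mult.assoc)
    then have "S = V p q n"
      unfolding sign h unfolding e by (simp add: V_def algebra_simps flip: m_def)
    then show ?thesis using root by simp
  next
    case below
    define a where "a = q - p + n - 1"
    have off: "t \<noteq> real i" for i using below by (simp add: t_def)
    have le: "n \<le> a" "a - n = q - p - 1" using below by (simp_all add: a_def)
    \<comment> \<open>Reversing the index turns the denominators \<open>t - i\<close> into \<open>-(a - i)\<close>.\<close>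
    have rev: "(\<Sum>i<n. f (t - real i)) = (\<Sum>i<n. f (- (real a - real i)))" for f :: "real \<Rightarrow> real"
      by (rule sum.reindex_bij_witness[of _ "\<lambda>i. n - 1 - i" "\<lambda>i. n - 1 - i"])
         (use below in \<open>auto simp: t_def a_def of_nat_diff algebra_simps\<close>)
    have s1: "(\<Sum>i<n. 1 / (t - real i)) = harm (q - p - 1) - harm (q - p + n - 1)"
      using sum_inverse_consecutive_harm[OF le(1)]
      unfolding rev[of "\<lambda>x. 1 / x"] minus_divide_right[symmetric] sum_negf le(2)
      by (simp add: a_def)
    have s2: "(\<Sum>i<n. 1 / (t - real i)\<^sup>2) =
                gen_harm 2 (q - p + n - 1) - gen_harm 2 (q - p - 1)"
      using sum_inverse_consecutive[OF le(1), of 2]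
      unfolding rev[of "\<lambda>x. 1 / x\<^sup>2"] power2_minus le(2) by (simp add: a_def)
    have "S = W p q n"
      using harmonic_convolution_off_roots[of n p q, folded t_def S_def, OF off]
      unfolding s1 s2 by (simp add: W_def t_def algebra_simps)
    then show ?thesis using below by simp
  qed
  then show ?thesis by (simp add: S_def atMost_atLeast0)
qed

end
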